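(* Let $\Omega=\prod_{k=1}^n\Omega_k$ with product probability measure $\mu=\bigotimes_{k=1}^n\mu_k$, and let $f$ be a bounded measurable real function on $\Omega$. Suppose that $$E_k[f]\ge\frac{\sup_kf+\inf_kf}{2}\qquad\text{for all }k\in\{1,\ldots,n\}$$ (pointwise on $\Omega$), and let $$A=\left\Vert\sum_{k=1}^n\bigl(\sup_kf-E_k[f]\bigr)\bigl(E_k[f]-\inf_kf\bigr)\right\Vert_\infty .$$ Then for every $t>0$ $$\Pr\{f-E[f]>t\}\le\mathrm{e}^{-t^2/(2A)} .$$
   Context: $E[g]=\int_\Omega g\,\mathrm{d}\mu$, $\Pr$ is probability under $\mu$, and $\Vert\cdot\Vert_\infty$ is the norm of $L_\infty[\mu]$. For $\mathbf{x}\in\Omega$ and $y\in\Omega_k$, $\mathbf{x}_{y,k}$ denotes $\mathbf{x}$ with its $k$th coordinate replaced by $y$. Then $E_k[g](\mathbf{x})=\int_{\Omega_k}g(\mathbf{x}_{y,k})\,\mathrm{d}\mu_k(y)$, $(\sup_kg)(\mathbf{x})=\sup_{y\in\Omega_k}g(\mathbf{x}_{y,k})$ and $(\inf_kg)(\mathbf{x})=\inf_{y\in\Omega_k}g(\mathbf{x}_{y,k})$. Measurability questions are ignored: the functions $\sup_kf$ and $\inf_kf$ are assumed measurable. If $A=0$ the right-hand side is read as $0$. *)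

theory Defs
  imports "HOL-Probability.Probability"
begin

text \<open>
  Points of the product space \<open>\<Pi>\<^sub>M k\<in>{1..n}. M k\<close> are extensional functions on \<open>{1..n}\<close>, so
  \<open>x(k := y)\<close> is the point \<open>x\<close> with its \<open>k\<close>th coordinate replaced by \<open>y\<close>.
  The individual spaces \<open>\<Omega>\<^sub>k = space (M k)\<close> may differ; they only share an ambient type.
\<close>

definition coord_expectation ::
    "(nat \<Rightarrow> 'a measure) \<Rightarrow> nat \<Rightarrow> ((nat \<Rightarrow> 'a) \<Rightarrow> real) \<Rightarrow> (nat \<Rightarrow> 'a) \<Rightarrow> real"
  where "coord_expectation M k g x = (\<integral>y. g (x(k := y)) \<partial>M k)"

text \<open>
  The real-valued suprema and infima below are the usual ones only for sections of \<open>g\<close> that are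
  bounded on a nonempty space.
\<close>

definition coord_sup ::
    "(nat \<Rightarrow> 'a measure) \<Rightarrow> nat \<Rightarrow> ((nat \<Rightarrow> 'a) \<Rightarrow> real) \<Rightarrow> (nat \<Rightarrow> 'a) \<Rightarrow> real"
  where "coord_sup M k g x = (SUP y\<in>space (M k). g (x(k := y)))"

definition coord_inf ::
    "(nat \<Rightarrow> 'a measure) \<Rightarrow> nat \<Rightarrow> ((nat \<Rightarrow> 'a) \<Rightarrow> real) \<Rightarrow> (nat \<Rightarrow> 'a) \<Rightarrow> real"
  where "coord_inf M k g x = (INF y\<in>space (M k). g (x(k := y)))"

text \<open>
  \<open>esssup\<close> requires a complete linear order, hence the detour through \<open>ereal\<close>. The result is the
  usual norm whenever \<open>g\<close> is measurable and essentially bounded and \<open>N\<close> is not the zero measure;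
  for other \<open>g\<close> the value is a meaningless real number.
\<close>

definition Linfty_norm :: "'b measure \<Rightarrow> ('b \<Rightarrow> real) \<Rightarrow> real"
  where "Linfty_norm N g = real_of_ereal (esssup N (\<lambda>x. ereal \<bar>g x\<bar>))"

end

theory Submission
  imports Defs
begin

text \<open>
  Entropy method. The entropy \<open>E[h e\<^sup>h] - E[e\<^sup>h] ln E[e\<^sup>h]\<close> is subadditive over product measures, by
  Gibbs' variational principle. In one coordinate, the derivative of the tilted mean
  \<open>E[f e\<^sup>s\<^sup>f] / E[e\<^sup>s\<^sup>f]\<close> is the tilted variance, which is at most \<open>(sup f - m)(m - inf f)\<close> with \<open>m\<close> the
  tilted mean. Tilting with \<open>s \<ge> 0\<close> only increases the mean, and the midpoint condition puts it
  where this bound decreases in \<open>m\<close>, so \<open>m\<close> may be replaced by the untilted mean. Hence the entropy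
  of \<open>e\<^sup>s\<^sup>f\<close> is at most \<open>s\<^sup>2 A / 2\<close> times \<open>E[e\<^sup>s\<^sup>f]\<close>; Herbst's argument integrates this to
  \<open>ln E[e\<^sup>s\<^sup>(\<^sup>f\<^sup>-\<^sup>E\<^sup>f\<^sup>)] \<le> s\<^sup>2 A / 2\<close>, and Markov's inequality finishes.
\<close>

section \<open>Entropy of exponentials of bounded functions\<close>

lemma (in finite_measure) integrable_bounded:
  fixes f :: "'a \<Rightarrow> real"
  assumes "f \<in> borel_measurable M" "\<And>x. x \<in> space M \<Longrightarrow> \<bar>f x\<bar> \<le> B"
  shows "integrable M f"
  using assms by (intro integrable_const_bound[where B = B]) auto

lemma (in prob_space) integral_bounds:
  fixes f :: "'a \<Rightarrow> real"
  assumes "f \<in> borel_measurable M" "\<And>x. x \<in> space M \<Longrightarrow> a \<le> f x \<and> f x \<le> b"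
  shows "a \<le> (\<integral>x. f x \<partial>M)" "(\<integral>x. f x \<partial>M) \<le> b"
proof -
  have int: "integrable M f"
    using assms by (intro integrable_bounded[where B = "max \<bar>a\<bar> \<bar>b\<bar>"]) fastforce+
  show "a \<le> (\<integral>x. f x \<partial>M)" "(\<integral>x. f x \<partial>M) \<le> b"
    using assms by (auto intro!: integral_ge_const integral_le_const int)
qed

text \<open>The functional E[u ln u] - E[u] ln E[u] at u = exp h. Taking the exponent h as the
  argument makes u positive by construction, and boundedness of h is then all that the integrability
  arguments use.\<close>

definition entropy_exp :: "'b measure \<Rightarrow> ('b \<Rightarrow> real) \<Rightarrow> real" where
  "entropy_exp M h = (\<integral>x. h x * exp (h x) \<partial>M) - (\<integral>x. exp (h x) \<partial>M) * ln (\<integral>x. exp (h x) \<partial>M)"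

context prob_space
begin

context
  fixes h :: "'a \<Rightarrow> real" and K :: real
  assumes h_meas [measurable]: "h \<in> borel_measurable M"
    and h_bound: "\<And>x. x \<in> space M \<Longrightarrow> \<bar>h x\<bar> \<le> K"
begin

lemma exp_h_bounds: "x \<in> space M \<Longrightarrow> exp (- K) \<le> exp (h x) \<and> exp (h x) \<le> exp K"
  using h_bound[of x] by (auto simp: abs_le_iff)

lemma integral_exp_bounds:
  "exp (- K) \<le> (\<integral>x. exp (h x) \<partial>M)" "(\<integral>x. exp (h x) \<partial>M) \<le> exp K"
  using integral_bounds[of "\<lambda>x. exp (h x)" "exp (- K)" "exp K"] exp_h_bounds by auto

lemma integral_exp_pos: "0 < (\<integral>x. exp (h x) \<partial>M)"
  using integral_exp_bounds(1) exp_gt_zero[of "- K"] by linarith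

lemma ln_integral_exp_bound: "\<bar>ln (\<integral>x. exp (h x) \<partial>M)\<bar> \<le> K"
proof -
  have "- K \<le> ln (\<integral>x. exp (h x) \<partial>M)"
    using integral_exp_bounds(1) integral_exp_pos by (simp add: ln_ge_iff)
  moreover have "ln (\<integral>x. exp (h x) \<partial>M) \<le> K"
    using integral_exp_bounds(2) integral_exp_pos by (metis ln_exp ln_mono)
  ultimately show ?thesis by simp
qed

lemma integrable_mult_exp:
  assumes [measurable]: "g \<in> borel_measurable M" and g: "\<And>x. x \<in> space M \<Longrightarrow> \<bar>g x\<bar> \<le> B"
  shows "integrable M (\<lambda>x. g x * exp (h x))"
proof (rule integrable_bounded)
  fix x assume x: "x \<in> space M"
  have "\<bar>g x\<bar> * exp (h x) \<le> B * exp K"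
    using g[OF x] exp_h_bounds[OF x] by (intro mult_mono) auto
  then show "\<bar>g x * exp (h x)\<bar> \<le> B * exp K" by (simp add: abs_mult)
qed simp

lemma integrable_exp: "integrable M (\<lambda>x. exp (h x))"
  using integrable_mult_exp[of "\<lambda>_. 1" 1] by simp

text \<open>The bound is crude; it serves only to make the entropies of sections integrable in the
  remaining variables.\<close>

lemma abs_entropy_exp_le: "\<bar>entropy_exp M h\<bar> \<le> 2 * (K * exp K)"
proof -
  let ?m = "\<integral>x. exp (h x) \<partial>M"
  have "\<bar>h x * exp (h x)\<bar> \<le> K * exp K" if "x \<in> space M" for x
    using h_bound[OF that] exp_h_bounds[OF that] by (auto simp: abs_mult intro!: mult_mono)
  then have "- (K * exp K) \<le> (\<integral>x. h x * exp (h x) \<partial>M)" "(\<integral>x. h x * exp (h x) \<partial>M) \<le> K * exp K"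
    using integral_bounds[of "\<lambda>x. h x * exp (h x)" "- (K * exp K)" "K * exp K"]
    by (auto simp: abs_le_iff minus_le_iff)
  moreover have "\<bar>?m * ln ?m\<bar> \<le> exp K * K"
    unfolding abs_mult
    using integral_exp_bounds integral_exp_pos ln_integral_exp_bound by (intro mult_mono) auto
  ultimately show ?thesis
    unfolding entropy_exp_def by (simp add: abs_le_iff mult.commute)
qed

text \<open>This is nonnegativity of the relative entropy of the density exp h / m with respect to
  exp g / m', multiplied by m, where m and m' are the normalising integrals. Equality holds at g =
  h, so the entropy is a maximum over g of expressions linear in exp h; that linearity is what
  allows averaging over a further variable.\<close>

lemma gibbs_variational:
  assumes [measurable]: "g \<in> borel_measurable M" and g: "\<And>x. x \<in> space M \<Longrightarrow> \<bar>g x\<bar> \<le> L"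
  shows "(\<integral>x. g x * exp (h x) \<partial>M) - (\<integral>x. exp (h x) \<partial>M) * ln (\<integral>x. exp (g x) \<partial>M)
    \<le> entropy_exp M h"
proof -
  define m where "m = (\<integral>x. exp (h x) \<partial>M)"
  define m' where "m' = (\<integral>x. exp (g x) \<partial>M)"
  have m: "m > 0" unfolding m_def by (rule integral_exp_pos)
  have m': "m' > 0" unfolding m'_def
    using prob_space.integral_exp_pos[OF prob_space_axioms assms] .
  note [simp] = integrable_mult_exp[OF assms] integrable_mult_exp[OF h_meas h_bound]
    integrable_exp prob_space.integrable_exp[OF prob_space_axioms assms]
  have "(\<integral>x. g x * exp (h x) - h x * exp (h x) + (ln m - ln m') * exp (h x) \<partial>M)
      \<le> (\<integral>x. (m / m') * exp (g x) - exp (h x) \<partial>M)"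
  proof (rule integral_mono)
    fix x assume "x \<in> space M"
    \<comment> \<open>\<open>?u\<close> is the logarithm of the ratio of the two normalised
      densities. Hence exp h * exp \<open>?u\<close> equals (m / m') * exp g, whose integral is m,
      and the right-hand side of the pointwise bound integrates to m - m = 0.\<close>
    let ?u = "g x - h x + (ln m - ln m')"
    have "?u \<le> exp ?u - 1" using exp_ge_add_one_self[of ?u] by linarith
    then have "exp (h x) * ?u \<le> exp (h x) * (exp ?u - 1)" by (rule mult_left_mono) simp
    also have "\<dots> = (m / m') * exp (g x) - exp (h x)"
      using m m' by (simp add: exp_add exp_diff field_simps)
    finally show "g x * exp (h x) - h x * exp (h x) + (ln m - ln m') * exp (h x)
        \<le> (m / m') * exp (g x) - exp (h x)"
      by (simp add: algebra_simps)
  qed simp_all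
  also have "\<dots> = 0"
    using m' by (simp add: m_def[symmetric] m'_def[symmetric])
  finally show ?thesis
    unfolding entropy_exp_def m_def[symmetric] m'_def[symmetric]
    by (simp add: m_def[symmetric] algebra_simps)
qed

end

end

section \<open>Subadditivity of entropy over product measures\<close>

lemma entropy_exp_measurable:
  assumes "sigma_finite_measure N"
    and [measurable]: "case_prod h \<in> borel_measurable (L \<Otimes>\<^sub>M N)"
  shows "(\<lambda>x. entropy_exp N (h x)) \<in> borel_measurable L"
proof -
  interpret sigma_finite_measure N by fact
  have [measurable]: "(\<lambda>x. \<integral>y. h x y * exp (h x y) \<partial>N) \<in> borel_measurable L"
    "(\<lambda>x. \<integral>y. exp (h x y) \<partial>N) \<in> borel_measurable L"
    by measurable
  show ?thesis unfolding entropy_exp_def by measurable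
qed

text \<open>With exp (q y) the integral of exp (h x y) over x, the joint entropy is the average over
  y of the X-entropies plus the Y-entropy of exp q. The latter is compared with the average of the
  Y-entropies of the sections: for every x, use q as test function in Gibbs' principle on Y, then
  integrate over x.\<close>

lemma entropy_exp_pair_le:
  fixes h :: "'b \<Rightarrow> 'c \<Rightarrow> real"
  assumes X: "prob_space X" and Y: "prob_space Y"
    and hm [measurable]: "case_prod h \<in> borel_measurable (X \<Otimes>\<^sub>M Y)"
    and hb: "\<And>x y. x \<in> space X \<Longrightarrow> y \<in> space Y \<Longrightarrow> \<bar>h x y\<bar> \<le> K"
  shows "(\<integral>x. \<integral>y. h x y * exp (h x y) \<partial>Y \<partial>X)
      - (\<integral>x. \<integral>y. exp (h x y) \<partial>Y \<partial>X) * ln (\<integral>x. \<integral>y. exp (h x y) \<partial>Y \<partial>X)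
    \<le> (\<integral>y. entropy_exp X (\<lambda>x. h x y) \<partial>Y) + (\<integral>x. entropy_exp Y (h x) \<partial>X)"
proof -
  interpret X: prob_space X by fact
  interpret Y: prob_space Y by fact
  interpret XY: pair_prob_space X Y by unfold_locales
  have hx [measurable]: "h x \<in> borel_measurable Y" if "x \<in> space X" for x
    using measurable_compose[OF measurable_Pair1'[OF that] hm] by simp
  have hy [measurable]: "(\<lambda>x. h x y) \<in> borel_measurable X" if "y \<in> space Y" for y
    using measurable_compose[OF measurable_Pair2'[OF that] hm] by simp
  have sw: "(\<lambda>(y, x). h x y) \<in> borel_measurable (Y \<Otimes>\<^sub>M X)"
    using measurable_pair_swap[OF hm] by (simp add: case_prod_beta)
  have mX [measurable]: "(\<lambda>y. \<integral>x. exp (h x y) \<partial>X) \<in> borel_measurable Y"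
    using sw by (intro X.borel_measurable_lebesgue_integral) (simp add: case_prod_beta)
  define q where "q y = ln (\<integral>x. exp (h x y) \<partial>X)" for y
  have qm [measurable]: "q \<in> borel_measurable Y" unfolding q_def by measurable
  have qb: "\<bar>q y\<bar> \<le> K" if "y \<in> space Y" for y
    unfolding q_def using that hb by (intro X.ln_integral_exp_bound) auto
  have exp_q: "exp (q y) = (\<integral>x. exp (h x y) \<partial>X)" if "y \<in> space Y" for y
    unfolding q_def using X.integral_exp_pos[OF hy[OF that] hb[OF _ that]] by simp
  \<comment> \<open>The weight g stays general in the three Fubini facts: they are applied with g
    equal to h, to q and to the constant 1.\<close>
  have XYi: "integrable (X \<Otimes>\<^sub>M Y) (\<lambda>(x, y). g x y * exp (h x y))"
    if [measurable]: "case_prod g \<in> borel_measurable (X \<Otimes>\<^sub>M Y)"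
      and "\<And>x y. x \<in> space X \<Longrightarrow> y \<in> space Y \<Longrightarrow> \<bar>g x y\<bar> \<le> B" for g B
    using XY.integrable_mult_exp[of "case_prod h" K "case_prod g" B] that hb
    by (auto simp: split_beta' space_pair_measure)
  have swap: "(\<integral>x. \<integral>y. g x y * exp (h x y) \<partial>Y \<partial>X) = (\<integral>y. \<integral>x. g x y * exp (h x y) \<partial>X \<partial>Y)"
    if "case_prod g \<in> borel_measurable (X \<Otimes>\<^sub>M Y)"
      and "\<And>x y. x \<in> space X \<Longrightarrow> y \<in> space Y \<Longrightarrow> \<bar>g x y\<bar> \<le> B" for g B
    using XY.Fubini_integral[OF XYi[OF that]] by simp
  have YXi: "integrable X (\<lambda>x. \<integral>y. g x y * exp (h x y) \<partial>Y)"
    if "case_prod g \<in> borel_measurable (X \<Otimes>\<^sub>M Y)"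
      and "\<And>x y. x \<in> space X \<Longrightarrow> y \<in> space Y \<Longrightarrow> \<bar>g x y\<bar> \<le> B" for g B
    using XY.integrable_fst'[OF XYi[OF that]] by simp
  define m where "m = (\<integral>x. \<integral>y. exp (h x y) \<partial>Y \<partial>X)"
  have m_eq: "m = (\<integral>y. exp (q y) \<partial>Y)"
    unfolding m_def using swap[of "\<lambda>_ _. 1" 1] by (simp add: exp_q cong: Bochner_Integration.integral_cong)
  have "(\<integral>x. (\<integral>y. q y * exp (h x y) \<partial>Y) - (\<integral>y. exp (h x y) \<partial>Y) * ln m \<partial>X)
      \<le> (\<integral>x. entropy_exp Y (h x) \<partial>X)"
  proof (rule integral_mono)
    show "integrable X (\<lambda>x. (\<integral>y. q y * exp (h x y) \<partial>Y) - (\<integral>y. exp (h x y) \<partial>Y) * ln m)"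
      using YXi[of "\<lambda>_. q" K] YXi[of "\<lambda>_ _. 1" 1] qb by simp
    show "integrable X (\<lambda>x. entropy_exp Y (h x))"
      by (rule X.integrable_bounded[OF entropy_exp_measurable[OF Y.sigma_finite_measure_axioms hm]])
        (use Y.abs_entropy_exp_le[OF hx hb] in auto)
    show "(\<integral>y. q y * exp (h x y) \<partial>Y) - (\<integral>y. exp (h x y) \<partial>Y) * ln m \<le> entropy_exp Y (h x)"
      if "x \<in> space X" for x
      unfolding m_eq using Y.gibbs_variational[OF hx[OF that] hb[OF that] qm qb] .
  qed
  moreover have "(\<integral>x. (\<integral>y. q y * exp (h x y) \<partial>Y) - (\<integral>y. exp (h x y) \<partial>Y) * ln m \<partial>X)
      = (\<integral>y. \<integral>x. q y * exp (h x y) \<partial>X \<partial>Y) - m * ln m"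
    using YXi[of "\<lambda>_. q" K] YXi[of "\<lambda>_ _. 1" 1] swap[of "\<lambda>_. q" K] qb by (simp add: m_def)
  \<comment> \<open>The subtracted term of the X-entropy at y is exp (q y) * q y. Written as the
    integral of q y * exp (h x y) over x, it cancels against the left-hand side of the averaged
    Gibbs inequality.\<close>
  moreover have "(\<integral>y. entropy_exp X (\<lambda>x. h x y) \<partial>Y)
      = (\<integral>x. \<integral>y. h x y * exp (h x y) \<partial>Y \<partial>X) - (\<integral>y. \<integral>x. q y * exp (h x y) \<partial>X \<partial>Y)"
  proof -
    have "(\<integral>y. entropy_exp X (\<lambda>x. h x y) \<partial>Y)
        = (\<integral>y. (\<integral>x. h x y * exp (h x y) \<partial>X) - (\<integral>x. q y * exp (h x y) \<partial>X) \<partial>Y)"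
      by (simp add: entropy_exp_def q_def mult.commute)
    also have "\<dots> = (\<integral>y. \<integral>x. h x y * exp (h x y) \<partial>X \<partial>Y) - (\<integral>y. \<integral>x. q y * exp (h x y) \<partial>X \<partial>Y)"
      using XY.integrable_snd[OF XYi[OF hm hb]] XY.integrable_snd[OF XYi[of "\<lambda>_. q" K]] qb
      by (intro Bochner_Integration.integral_diff) auto
    finally show ?thesis using swap[OF hm hb] by simp
  qed
  ultimately show ?thesis unfolding m_def by linarith
qed

text \<open>The index k may already lie in I, and then J = I. So this covers both adding a new
  coordinate in an induction and replacing an existing one.\<close>

lemma measurable_case_update:
  assumes "g \<in> Pi\<^sub>M J M \<rightarrow>\<^sub>M N" "J = insert k I"
  shows "(\<lambda>(x, y). g (x(k := y))) \<in> Pi\<^sub>M I M \<Otimes>\<^sub>M M k \<rightarrow>\<^sub>M N"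
proof -
  have "(\<lambda>(x, y). g (x(k := y))) = (\<lambda>p. g (case p of (x, y) \<Rightarrow> x(k := y)))"
    by (rule ext) (simp split: prod.split)
  then show ?thesis
    using measurable_compose[OF measurable_add_dim assms(1)[unfolded assms(2)]] by simp
qed

lemma measurable_update_section:
  assumes "g \<in> Pi\<^sub>M J M \<rightarrow>\<^sub>M N" "J = insert k I" "x \<in> space (Pi\<^sub>M I M)"
  shows "(\<lambda>y. g (x(k := y))) \<in> M k \<rightarrow>\<^sub>M N"
  using measurable_compose[OF measurable_Pair1'[OF assms(3)] measurable_case_update[OF assms(1,2)]]
  by simp

lemma space_PiM_update:
  assumes "k \<in> I" "x \<in> space (Pi\<^sub>M I M)" "y \<in> space (M k)"
  shows "x(k := y) \<in> space (Pi\<^sub>M I M)"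
  using PiE_fun_upd[of y "\<lambda>i. space (M i)" k x I] assms by (simp add: space_PiM insert_absorb)

text \<open>Redrawing coordinate k independently from \<open>M k\<close> preserves the product
  measure. It turns averages over sections back into integrals over the whole space.\<close>

lemma integral_PiM_coord:
  fixes g :: "('i \<Rightarrow> 'a) \<Rightarrow> real"
  assumes M: "\<And>i. prob_space (M i)" and "finite I" "k \<in> I"
    and g: "g \<in> borel_measurable (Pi\<^sub>M I M)" "\<And>x. x \<in> space (Pi\<^sub>M I M) \<Longrightarrow> \<bar>g x\<bar> \<le> B"
  shows "(\<integral>x. \<integral>y. g (x(k := y)) \<partial>M k \<partial>Pi\<^sub>M I M) = (\<integral>x. g x \<partial>Pi\<^sub>M I M)"
proof -
  interpret product_prob_space M I
    by (intro product_prob_space.intro product_sigma_finite.intro product_prob_space_axioms.intro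
      prob_space_imp_sigma_finite M)
  define J where "J = I - {k}"
  have I: "I = insert k J" and J: "finite J" "k \<notin> J"
    using assms unfolding J_def by auto
  have P: "prob_space (Pi\<^sub>M I M)" by (intro prob_space_PiM M)
  have int_g: "integrable (Pi\<^sub>M I M) g"
    using P by (intro finite_measure.integrable_bounded[OF _ g]) (auto simp: prob_space_def)
  have m: "(\<lambda>x. \<integral>y. g (x(k := y)) \<partial>M k) \<in> borel_measurable (Pi\<^sub>M I M)"
    using assms(3) by (intro M.borel_measurable_lebesgue_integral measurable_case_update[OF g(1)]) auto
  have b: "\<bar>\<integral>y. g (x(k := y)) \<partial>M k\<bar> \<le> B" if x: "x \<in> space (Pi\<^sub>M I M)" for x
  proof -
    have "(\<lambda>y. g (x(k := y))) \<in> borel_measurable (M k)"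
      using assms(3) by (intro measurable_update_section[OF g(1) _ x]) auto
    then show ?thesis
      using M.integral_bounds[of "\<lambda>y. g (x(k := y))" k "- B" B] g(2)[OF space_PiM_update[OF \<open>k \<in> I\<close> x]]
      by (simp add: abs_le_iff minus_le_iff)
  qed
  have int: "integrable (Pi\<^sub>M I M) (\<lambda>x. \<integral>y. g (x(k := y)) \<partial>M k)"
    using P by (intro finite_measure.integrable_bounded[OF _ m b]) (auto simp: prob_space_def)
  \<comment> \<open>Both sides become iterated integrals over J and coordinate k. On the left the
    second replacement overwrites the first, so the old coordinate k integrates a constant against
    total mass 1.\<close>
  show ?thesis
    using product_integral_insert[OF J int[unfolded I]] product_integral_insert[OF J int_g[unfolded I]]
    by (simp add: I M.prob_space)
qed

text \<open>Induction on I. A new coordinate i is split off with the inequality for pairs; the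
  induction hypothesis is then applied to the slice at each fixed value y of that
  coordinate.\<close>

lemma entropy_exp_PiM_le:
  fixes h :: "('i \<Rightarrow> 'a) \<Rightarrow> real"
  assumes M: "\<And>i. prob_space (M i)" and "finite I" and "h \<in> borel_measurable (Pi\<^sub>M I M)"
    and "\<And>x. x \<in> space (Pi\<^sub>M I M) \<Longrightarrow> \<bar>h x\<bar> \<le> K"
  shows "entropy_exp (Pi\<^sub>M I M) h
    \<le> (\<Sum>k\<in>I. \<integral>x. entropy_exp (M k) (\<lambda>y. h (x(k := y))) \<partial>Pi\<^sub>M I M)"
  using assms(2-)
proof (induction I arbitrary: h rule: finite_induct)
  case empty
  interpret prob_space "Pi\<^sub>M {} M" by (intro prob_space_PiM M)
  \<comment> \<open>The empty product has the single point that is \<open>undefined\<close>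
    everywhere, so h is constant there and its entropy is 0.\<close>
  have *: "(\<integral>x. g x \<partial>Pi\<^sub>M {} M) = g (\<lambda>_. undefined)" for g :: "_ \<Rightarrow> real"
  proof -
    have "(\<integral>x. g x \<partial>Pi\<^sub>M {} M) = (\<integral>x. g (\<lambda>_. undefined) \<partial>Pi\<^sub>M {} M)"
      by (intro Bochner_Integration.integral_cong) (auto simp: space_PiM)
    then show ?thesis by (simp add: prob_space)
  qed
  show ?case by (simp add: entropy_exp_def *)
next
  case (insert i I)
  interpret product_prob_space M I
    by (intro product_prob_space.intro product_sigma_finite.intro product_prob_space_axioms.intro
      prob_space_imp_sigma_finite M)
  let ?X = "Pi\<^sub>M I M" and ?Z = "Pi\<^sub>M (insert i I) M"
  interpret Z: prob_space ?Z by (intro prob_space_PiM M)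
  interpret XY: pair_prob_space ?X "M i" by unfold_locales
  note hm [measurable] = insert.prems(1) and hb = insert.prems(2)
  define H where "H x y = h (x(i := y))" for x y
  have Hm [measurable]: "case_prod H \<in> borel_measurable (?X \<Otimes>\<^sub>M M i)"
    using measurable_case_update[OF hm refl] by (simp add: H_def[abs_def])
  have upd: "x(i := y) \<in> space ?Z" if "x \<in> space ?X" "y \<in> space (M i)" for x y
    using that unfolding space_PiM by (intro PiE_fun_upd)
  have Hb: "\<bar>H x y\<bar> \<le> K" if "x \<in> space ?X" "y \<in> space (M i)" for x y
    unfolding H_def using hb[OF upd[OF that]] .
  have Hy [measurable]: "(\<lambda>x. H x y) \<in> borel_measurable ?X" if "y \<in> space (M i)" for y
    using measurable_compose[OF measurable_Pair2'[OF that] Hm] by simp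
  define E where "E k x = entropy_exp (M k) (\<lambda>y. h (x(k := y)))" for k x
  have Em: "E k \<in> borel_measurable ?Z" if "k \<in> insert i I" for k
    unfolding E_def using that
    by (intro entropy_exp_measurable M.sigma_finite_measure_axioms measurable_case_update[OF hm]) auto
  have Eb: "\<bar>E k x\<bar> \<le> 2 * (K * exp K)" if k: "k \<in> insert i I" and x: "x \<in> space ?Z" for k x
    unfolding E_def
  proof (rule M.abs_entropy_exp_le)
    show "(\<lambda>y. h (x(k := y))) \<in> borel_measurable (M k)"
      using k by (intro measurable_update_section[OF hm _ x]) auto
  qed (use hb space_PiM_update[OF k x] in auto)
  \<comment> \<open>The iterated integral is needed in both orders: \<open>M i\<close> innermost for
    the summand k = i, and \<open>?X\<close> innermost for the summands from the induction
    hypothesis.\<close>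
  have E_int: "(\<integral>x. E k x \<partial>?Z) = (\<integral>x. \<integral>y. E k (x(i := y)) \<partial>M i \<partial>?X)"
    and E_swap: "(\<integral>x. E k x \<partial>?Z) = (\<integral>y. \<integral>x. E k (x(i := y)) \<partial>?X \<partial>M i)"
    and E_intg: "integrable (M i) (\<lambda>y. \<integral>x. E k (x(i := y)) \<partial>?X)"
    if k: "k \<in> insert i I" for k
  proof -
    have int: "integrable (?X \<Otimes>\<^sub>M M i) (\<lambda>(x, y). E k (x(i := y)))"
    proof (rule XY.integrable_bounded)
      show "(\<lambda>(x, y). E k (x(i := y))) \<in> borel_measurable (?X \<Otimes>\<^sub>M M i)"
        by (rule measurable_case_update[OF Em[OF k] refl])
      show "\<bar>case p of (x, y) \<Rightarrow> E k (x(i := y))\<bar> \<le> 2 * (K * exp K)"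
        if "p \<in> space (?X \<Otimes>\<^sub>M M i)" for p
        using that Eb[OF k upd] by (auto simp: space_pair_measure)
    qed
    show 1: "(\<integral>x. E k x \<partial>?Z) = (\<integral>x. \<integral>y. E k (x(i := y)) \<partial>M i \<partial>?X)"
      using insert.hyps Z.integrable_bounded[OF Em[OF k] Eb[OF k]] by (rule product_integral_insert)
    show "(\<integral>x. E k x \<partial>?Z) = (\<integral>y. \<integral>x. E k (x(i := y)) \<partial>?X \<partial>M i)"
      unfolding 1 using XY.Fubini_integral[OF int] by simp
    show "integrable (M i) (\<lambda>y. \<integral>x. E k (x(i := y)) \<partial>?X)"
      using XY.integrable_snd[OF int] by simp
  qed
  have eq: "entropy_exp ?Z h = (\<integral>x. \<integral>y. H x y * exp (H x y) \<partial>M i \<partial>?X)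
      - (\<integral>x. \<integral>y. exp (H x y) \<partial>M i \<partial>?X) * ln (\<integral>x. \<integral>y. exp (H x y) \<partial>M i \<partial>?X)"
  proof -
    have "integrable ?Z (\<lambda>x. h x * exp (h x))" "integrable ?Z (\<lambda>x. exp (h x))"
      using Z.integrable_mult_exp[OF hm hb hm hb] Z.integrable_exp[OF hm hb] by auto
    then show ?thesis
      unfolding entropy_exp_def H_def by (simp only: product_integral_insert[OF insert.hyps])
  qed
  have "entropy_exp ?Z h \<le> (\<integral>y. entropy_exp ?X (\<lambda>x. H x y) \<partial>M i) + (\<integral>x. entropy_exp (M i) (H x) \<partial>?X)"
    unfolding eq using P.prob_space_axioms M Hm Hb by (rule entropy_exp_pair_le)
  also have "(\<integral>x. entropy_exp (M i) (H x) \<partial>?X) = (\<integral>x. E i x \<partial>?Z)"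
    unfolding E_int[OF insertI1] by (simp add: E_def H_def[abs_def] M.prob_space)
  also have "(\<integral>y. entropy_exp ?X (\<lambda>x. H x y) \<partial>M i) \<le> (\<integral>y. (\<Sum>k\<in>I. \<integral>x. E k (x(i := y)) \<partial>?X) \<partial>M i)"
  proof (rule integral_mono)
    show "integrable (M i) (\<lambda>y. entropy_exp ?X (\<lambda>x. H x y))"
    proof (rule M.integrable_bounded)
      show "(\<lambda>y. entropy_exp ?X (\<lambda>x. H x y)) \<in> borel_measurable (M i)"
        using measurable_pair_swap[OF Hm]
        by (intro entropy_exp_measurable P.sigma_finite_measure_axioms) (simp add: case_prod_beta)
      show "\<bar>entropy_exp ?X (\<lambda>x. H x y)\<bar> \<le> 2 * (K * exp K)" if "y \<in> space (M i)" for y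
        using that by (intro P.abs_entropy_exp_le Hy Hb)
    qed
    show "integrable (M i) (\<lambda>y. \<Sum>k\<in>I. \<integral>x. E k (x(i := y)) \<partial>?X)"
      using E_intg by auto
    show "entropy_exp ?X (\<lambda>x. H x y) \<le> (\<Sum>k\<in>I. \<integral>x. E k (x(i := y)) \<partial>?X)"
      if y: "y \<in> space (M i)" for y
    proof -
      \<comment> \<open>For k in I we have k different from i, so replacing coordinate k commutes
        with fixing coordinate i at y, and the entropies of the slice are values of
        \<open>E k\<close>.\<close>
      have "entropy_exp ?X (\<lambda>x. H x y)
          \<le> (\<Sum>k\<in>I. \<integral>x. entropy_exp (M k) (\<lambda>z. H (x(k := z)) y) \<partial>?X)"
        using Hy[OF y] Hb[OF _ y] by (rule insert.IH)
      also have "\<dots> = (\<Sum>k\<in>I. \<integral>x. E k (x(i := y)) \<partial>?X)"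
      proof (intro sum.cong refl)
        fix k assume "k \<in> I"
        then have "i \<noteq> k" using insert.hyps by auto
        then have "(x(k := z))(i := y) = (x(i := y))(k := z)" for x :: "'i \<Rightarrow> 'a" and z
          by (simp add: fun_upd_twist)
        then show "(\<integral>x. entropy_exp (M k) (\<lambda>z. H (x(k := z)) y) \<partial>?X) = (\<integral>x. E k (x(i := y)) \<partial>?X)"
          unfolding E_def H_def by (simp only:)
      qed
      finally show ?thesis .
    qed
  qed
  also have "\<dots> = (\<Sum>k\<in>I. \<integral>x. E k x \<partial>?Z)"
    using E_swap E_intg by (subst Bochner_Integration.integral_sum) auto
  finally show ?case
    unfolding sum.insert[OF insert.hyps] E_def by linarith
qed

section \<open>Exponential moments of one bounded function: derivatives, entropy bound and Herbst's
  argument\<close>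

lemma abs_exp_minus_one_le: "\<bar>exp u - 1\<bar> \<le> \<bar>u\<bar> * exp \<bar>u\<bar>" for u :: real
proof (cases "u \<ge> 0")
  case True
  \<comment> \<open>Rearranged, this is exp u - 1 <= u * exp u.\<close>
  have "(1 - u) * exp u \<le> exp (- u) * exp u"
    using exp_ge_add_one_self[of "- u"] by (intro mult_right_mono) auto
  then show ?thesis using True by (simp add: exp_minus algebra_simps)
next
  case False
  have "\<bar>exp u - 1\<bar> \<le> - u"
    using False exp_ge_add_one_self[of u] by (simp add: abs_if del: exp_ge_add_one_self)
  also have "\<dots> \<le> (- u) * exp \<bar>u\<bar>"
    using False mult_left_mono[of 1 "exp \<bar>u\<bar>" "- u"] by simp
  finally show ?thesis using False by simp
qed

context prob_space
begin

context
  fixes f :: "'a \<Rightarrow> real" and C :: real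
  assumes f_meas [measurable]: "f \<in> borel_measurable M"
    and f_bound: "\<And>x. x \<in> space M \<Longrightarrow> \<bar>f x\<bar> \<le> C"
begin

lemma scaled_bound: "x \<in> space M \<Longrightarrow> \<bar>s * f x\<bar> \<le> \<bar>s\<bar> * C"
  using f_bound[of x] by (simp add: abs_mult mult_left_mono)

lemma integrable_mult_exp_scaled:
  assumes "g \<in> borel_measurable M" "\<And>x. x \<in> space M \<Longrightarrow> \<bar>g x\<bar> \<le> B"
  shows "integrable M (\<lambda>x. g x * exp (s * f x))"
  using scaled_bound by (intro integrable_mult_exp[OF _ _ assms]) auto

text \<open>Differentiation under the integral sign, by dominated convergence along an arbitrary
  null sequence of nonzero increments. With g = 1 and g = f it yields the derivatives of the zeroth
  and first tilted moments.\<close>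

lemma DERIV_integral_exp:
  assumes [measurable]: "g \<in> borel_measurable M" and g: "\<And>x. x \<in> space M \<Longrightarrow> \<bar>g x\<bar> \<le> B"
  shows "((\<lambda>s. \<integral>x. g x * exp (s * f x) \<partial>M) has_real_derivative
    (\<integral>x. g x * f x * exp (s * f x) \<partial>M)) (at s)"
proof -
  have "(\<lambda>j. ((\<integral>x. g x * exp ((s + X j) * f x) \<partial>M) - (\<integral>x. g x * exp (s * f x) \<partial>M)) / X j)
      \<longlonglongrightarrow> (\<integral>x. g x * f x * exp (s * f x) \<partial>M)"
    if X0: "\<And>j. X j \<noteq> 0" and X: "X \<longlonglongrightarrow> 0" for X
  proof -
    obtain R where R: "\<And>j. \<bar>X j\<bar> \<le> R"
      using convergent_imp_Bseq[OF convergentI[OF X]] by (auto simp: Bseq_def)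
    \<comment> \<open>B bounds g and exp (|s| C) bounds exp (s f). The last factor bounds the
      difference quotient: \<open>abs_exp_minus_one_le\<close> supplies a factor
      \<open>\<bar>X j\<bar>\<close> that cancels the denominator, and R bounds the convergent
      sequence of increments.\<close>
    let ?w = "B * (exp (\<bar>s\<bar> * C) * (C * exp (R * C)))"
    have "(\<lambda>j. \<integral>x. g x * exp (s * f x) * ((exp (X j * f x) - 1) / X j) \<partial>M)
        \<longlonglongrightarrow> (\<integral>x. g x * exp (s * f x) * f x \<partial>M)"
    proof (rule integral_dominated_convergence[where w = "\<lambda>_. ?w"])
      show "AE x in M. (\<lambda>j. g x * exp (s * f x) * ((exp (X j * f x) - 1) / X j))
          \<longlonglongrightarrow> g x * exp (s * f x) * f x"
      proof (intro AE_I2 tendsto_mult tendsto_const)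
        fix x
        have "((\<lambda>u. exp (u * f x)) has_real_derivative f x) (at 0)"
          by (auto intro!: derivative_eq_intros)
        then have "((\<lambda>u. (exp (u * f x) - 1) / u) \<longlongrightarrow> f x) (at 0)"
          by (simp add: DERIV_def)
        then show "(\<lambda>j. (exp (X j * f x) - 1) / X j) \<longlonglongrightarrow> f x"
          using X0 X by (auto simp: tendsto_at_iff_sequentially o_def)
      qed
      show "AE x in M. norm (g x * exp (s * f x) * ((exp (X j * f x) - 1) / X j)) \<le> ?w" for j
      proof (rule AE_I2)
        fix x assume x: "x \<in> space M"
        let ?u = "X j * f x"
        have C: "C \<ge> 0" using f_bound[OF x] by linarith
        have R0: "R \<ge> 0" using R[of j] by linarith
        have "\<bar>exp ?u - 1\<bar> \<le> \<bar>?u\<bar> * exp \<bar>?u\<bar>" by (rule abs_exp_minus_one_le)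
        also have "\<dots> \<le> (\<bar>X j\<bar> * C) * exp (R * C)"
          using f_bound[OF x] R[of j] R0 C by (intro mult_mono) (auto simp: abs_mult mult_mono)
        finally have "\<bar>(exp ?u - 1) / X j\<bar> \<le> C * exp (R * C)"
          using X0[of j] by (simp add: field_simps)
        moreover have "exp (s * f x) \<le> exp (\<bar>s\<bar> * C)" using scaled_bound[OF x, of s] by simp
        ultimately show "norm (g x * exp (s * f x) * ((exp ?u - 1) / X j)) \<le> ?w"
          using g[OF x] C unfolding real_norm_def abs_mult mult.assoc
          by (intro mult_mono) auto
      qed
    qed simp_all
    moreover have "(\<integral>x. g x * exp (s * f x) * f x \<partial>M) = (\<integral>x. g x * f x * exp (s * f x) \<partial>M)"
      by (simp add: mult_ac)
    moreover have "(\<integral>x. g x * exp (s * f x) * ((exp (X j * f x) - 1) / X j) \<partial>M)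
        = ((\<integral>x. g x * exp ((s + X j) * f x) \<partial>M) - (\<integral>x. g x * exp (s * f x) \<partial>M)) / X j" for j
    proof -
      have "(\<integral>x. g x * exp (s * f x) * ((exp (X j * f x) - 1) / X j) \<partial>M)
          = (\<integral>x. (g x * exp ((s + X j) * f x) - g x * exp (s * f x)) / X j \<partial>M)"
        by (simp add: distrib_right exp_add algebra_simps)
      also have "\<dots> = (\<integral>x. g x * exp ((s + X j) * f x) - g x * exp (s * f x) \<partial>M) / X j"
        by simp
      finally show ?thesis
        using integrable_mult_exp_scaled[OF assms] by simp
    qed
    ultimately show ?thesis by (simp only:)
  qed
  then show ?thesis
    unfolding DERIV_def by (auto simp: tendsto_at_iff_sequentially o_def)
qed

lemma mgf_pos: "0 < (\<integral>x. exp (s * f x) \<partial>M)"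
  using scaled_bound by (intro integral_exp_pos) auto

lemma entropy_exp_scaled:
  "entropy_exp M (\<lambda>x. s * f x) = s * (\<integral>x. f x * exp (s * f x) \<partial>M)
    - (\<integral>x. exp (s * f x) \<partial>M) * ln (\<integral>x. exp (s * f x) \<partial>M)"
  by (simp add: entropy_exp_def mult.assoc)

text \<open>Divided by Z0, the entropy of exp (s f) is s * p s - ln (Z0 s), whose derivative in s is
  s * V s. A bound V s <= B for all s >= 0 therefore integrates from 0 to \<beta> to B * \<beta>^2 /
  2.\<close>

lemma entropy_exp_le_midpoint:
  fixes a b \<beta> :: real
  assumes ab: "\<And>x. x \<in> space M \<Longrightarrow> a \<le> f x \<and> f x \<le> b"
    and mid: "(a + b) / 2 \<le> (\<integral>x. f x \<partial>M)" and "\<beta> \<ge> 0"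
  defines "B \<equiv> (b - (\<integral>x. f x \<partial>M)) * ((\<integral>x. f x \<partial>M) - a)"
  shows "entropy_exp M (\<lambda>x. \<beta> * f x) \<le> \<beta>\<^sup>2 / 2 * ((\<integral>x. exp (\<beta> * f x) \<partial>M) * B)"
proof -
  define Z0 where "Z0 s = (\<integral>x. exp (s * f x) \<partial>M)" for s
  define Z1 where "Z1 s = (\<integral>x. f x * exp (s * f x) \<partial>M)" for s
  define Z2 where "Z2 s = (\<integral>x. f x * f x * exp (s * f x) \<partial>M)" for s
  \<comment> \<open>\<open>p s\<close> and \<open>V s\<close> are the mean and the variance of f
    under the probability density exp (s f) / Z0 s.\<close>
  define p where "p s = Z1 s / Z0 s" for s
  define V where "V s = (Z2 s - p s * Z1 s) / Z0 s" for s
  have ff: "\<bar>f x * f x\<bar> \<le> C * C" if "x \<in> space M" for x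
    unfolding abs_mult using f_bound[OF that] by (intro mult_mono) linarith+
  have int [simp]: "integrable M (\<lambda>x. exp (s * f x))" "integrable M (\<lambda>x. f x * exp (s * f x))"
    "integrable M (\<lambda>x. f x * f x * exp (s * f x))" for s
    using integrable_mult_exp_scaled[of "\<lambda>_. 1" 1 s] integrable_mult_exp_scaled[of f C s]
      integrable_mult_exp_scaled[of "\<lambda>x. f x * f x" "C * C" s] f_bound ff by auto
  have Z0: "Z0 s > 0" for s unfolding Z0_def by (rule mgf_pos)
  have D0: "(Z0 has_real_derivative Z1 s) (at s)" for s
    unfolding Z0_def[abs_def] Z1_def using DERIV_integral_exp[of "\<lambda>_. 1" 1 s] by simp
  have D1: "(Z1 has_real_derivative Z2 s) (at s)" for s
    unfolding Z1_def[abs_def] Z2_def using DERIV_integral_exp[of f C s] f_bound by simp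
  have Dp: "(p has_real_derivative V s) (at s)" for s
    unfolding p_def[abs_def] V_def using Z0[of s]
    by (auto intro!: derivative_eq_intros D0 D1 simp: field_simps)
  have pZ: "p s * Z0 s = Z1 s" for s using Z0[of s] by (simp add: p_def)
  have VZ: "V s * Z0 s = Z2 s - p s * Z1 s" for s using Z0[of s] by (simp add: V_def)
  have V_nonneg: "V s \<ge> 0" for s
  proof -
    have "0 \<le> (\<integral>x. (f x - p s)\<^sup>2 * exp (s * f x) \<partial>M)" by simp
    also have "\<dots> = (\<integral>x. f x * f x * exp (s * f x) - 2 * p s * (f x * exp (s * f x))
        + p s * p s * exp (s * f x) \<partial>M)"
      by (simp add: power2_eq_square algebra_simps)
    also have "\<dots> = Z2 s - 2 * p s * Z1 s + p s * (p s * Z0 s)"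
      unfolding Z0_def Z1_def Z2_def by simp
    also have "\<dots> = Z2 s - p s * Z1 s" unfolding pZ by simp
    finally have "0 \<le> Z2 s - p s * Z1 s" .
    then show ?thesis unfolding V_def using Z0[of s] by simp
  qed
  have p0: "p 0 = (\<integral>x. f x \<partial>M)"
    by (simp add: p_def Z1_def Z0_def prob_space)
  have p_mono: "(\<integral>x. f x \<partial>M) \<le> p s" if "s \<ge> 0" for s
    unfolding p0[symmetric] by (rule DERIV_nonneg_imp_nondecreasing[OF that]) (use Dp V_nonneg in blast)
  have V_le: "V s \<le> B" if "s \<ge> 0" for s
  proof -
    \<comment> \<open>The tilted mean of the nonnegative function (b - f) (f - a) gives the
      Bhatia-Davis inequality V s <= (b - p s) (p s - a).\<close>
    have "0 \<le> (\<integral>x. (b - f x) * (f x - a) * exp (s * f x) \<partial>M)"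
      using ab by (intro integral_nonneg_AE AE_I2) auto
    also have "\<dots> = (\<integral>x. (a + b) * (f x * exp (s * f x)) - a * b * exp (s * f x)
        - f x * f x * exp (s * f x) \<partial>M)"
      by (simp add: algebra_simps)
    also have "\<dots> = (a + b) * Z1 s - a * b * Z0 s - Z2 s"
      unfolding Z0_def Z1_def Z2_def by simp
    finally have "V s * Z0 s \<le> ((b - p s) * (p s - a)) * Z0 s"
      unfolding VZ pZ[symmetric] by (simp add: algebra_simps)
    then have "V s \<le> (b - p s) * (p s - a)" using Z0[of s] by simp
    also have "\<dots> \<le> B"
    proof -
      let ?m = "\<integral>x. f x \<partial>M"
      \<comment> \<open>This product is exactly B - (b - p s) (p s - a). Both factors are
        nonnegative because p s >= \<open>?m\<close> >= (a + b) / 2; this is where the midpoint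
        condition enters.\<close>
      have "0 \<le> (p s - ?m) * (p s + ?m - a - b)"
        using p_mono[OF that] mid by (intro mult_nonneg_nonneg) auto
      then show ?thesis unfolding B_def by (simp add: algebra_simps)
    qed
    finally show ?thesis .
  qed
  \<comment> \<open>\<open>\<phi> s\<close> is the claimed bound minus the entropy, both divided by
    \<open>Z0 s\<close>.\<close>
  define \<phi> where "\<phi> s = B * s\<^sup>2 / 2 - s * p s + ln (Z0 s)" for s
  have "\<phi> 0 \<le> \<phi> \<beta>"
  proof (rule DERIV_nonneg_imp_nondecreasing[OF \<open>\<beta> \<ge> 0\<close>])
    fix s :: real assume "0 \<le> s"
    have "(\<phi> has_real_derivative s * (B - V s)) (at s)"
      unfolding \<phi>_def[abs_def] using Z0[of s]
      by (auto intro!: derivative_eq_intros Dp D0 simp: p_def[symmetric] algebra_simps)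
    then show "\<exists>y. (\<phi> has_real_derivative y) (at s) \<and> 0 \<le> y"
      using V_le[OF \<open>0 \<le> s\<close>] \<open>0 \<le> s\<close> by (intro exI[of _ "s * (B - V s)"]) auto
  qed
  moreover have "\<phi> 0 = 0" by (simp add: \<phi>_def Z0_def prob_space)
  ultimately have "0 \<le> Z0 \<beta> * \<phi> \<beta>" using Z0[of \<beta>] by simp
  also have "\<dots> = \<beta>\<^sup>2 / 2 * (Z0 \<beta> * B) - (\<beta> * (p \<beta> * Z0 \<beta>) - Z0 \<beta> * ln (Z0 \<beta>))"
    unfolding \<phi>_def by (simp add: algebra_simps)
  finally show ?thesis
    unfolding entropy_exp_scaled pZ unfolding Z0_def Z1_def by simp
qed

text \<open>Divided by s^2 * Z0 s, the entropy bound says that ln (Z0 s) / s has derivative at most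
  A / 2. So q is nonincreasing on the interval from 0 (excluded) to \<beta>, and its value at
  \<beta> is at most its limit at 0, the mean of f.\<close>

lemma herbst:
  fixes A \<beta> :: real
  assumes ent: "\<And>s. s > 0 \<Longrightarrow>
      entropy_exp M (\<lambda>x. s * f x) \<le> s\<^sup>2 / 2 * (A * (\<integral>x. exp (s * f x) \<partial>M))"
    and \<beta>: "\<beta> > 0"
  shows "(\<integral>x. exp (\<beta> * f x) \<partial>M) \<le> exp (\<beta> * (\<integral>x. f x \<partial>M) + \<beta>\<^sup>2 / 2 * A)"
proof -
  define Z0 where "Z0 s = (\<integral>x. exp (s * f x) \<partial>M)" for s
  define Z1 where "Z1 s = (\<integral>x. f x * exp (s * f x) \<partial>M)" for s
  define q where "q s = ln (Z0 s) / s - A * s / 2" for s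
  let ?m = "\<integral>x. f x \<partial>M"
  have Z0: "Z0 s > 0" for s unfolding Z0_def by (rule mgf_pos)
  have D0: "(Z0 has_real_derivative Z1 s) (at s)" for s
    unfolding Z0_def[abs_def] Z1_def using DERIV_integral_exp[of "\<lambda>_. 1" 1 s] by simp
  have DL: "((\<lambda>s. ln (Z0 s)) has_real_derivative Z1 s / Z0 s) (at s)" for s
    using Z0[of s] by (auto intro!: derivative_eq_intros D0)
  have q_mono: "q \<beta> \<le> q r" if r: "0 < r" "r \<le> \<beta>" for r
  proof (rule DERIV_nonpos_imp_nonincreasing[OF r(2)])
    fix s assume "r \<le> s" "s \<le> \<beta>"
    then have s: "s > 0" using r by linarith
    let ?d = "(Z1 s / Z0 s * s - ln (Z0 s)) / s\<^sup>2 - A / 2"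
    have "(q has_real_derivative ?d) (at s)"
      unfolding q_def[abs_def] using s
      by (auto intro!: derivative_eq_intros D0 simp: Z0 power2_eq_square)
    moreover have "?d \<le> 0"
    proof -
      have "s * Z1 s - Z0 s * ln (Z0 s) \<le> s\<^sup>2 / 2 * (A * Z0 s)"
        using ent[OF s] unfolding entropy_exp_scaled Z0_def Z1_def .
      then have "(s * Z1 s - Z0 s * ln (Z0 s)) / Z0 s \<le> s\<^sup>2 / 2 * A"
        using Z0[of s] by (simp add: field_simps)
      then show ?thesis using Z0[of s] s by (simp add: field_simps)
    qed
    ultimately show "\<exists>y. (q has_real_derivative y) (at s) \<and> y \<le> 0" by blast
  qed
  \<comment> \<open>Since ln (Z0 0) = 0, this quotient is the difference quotient of ln Z0 at 0,
    whose limit is Z1 0 / Z0 0.\<close>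
  have "((\<lambda>s. ln (Z0 s) / s) \<longlongrightarrow> ?m) (at 0)"
    using DL[of 0] by (simp add: DERIV_def Z0_def Z1_def prob_space)
  then have "(q \<longlongrightarrow> ?m - A * 0 / 2) (at_right 0)"
    unfolding q_def[abs_def]
    by (intro tendsto_intros) (auto intro: tendsto_within_subset)
  moreover have "\<forall>\<^sub>F r in at_right 0. q \<beta> \<le> q r"
    using eventually_at_right_less[of 0] eventually_at_right_field[of "\<lambda>r. r < \<beta>" 0] \<beta>
    by (auto simp: eventually_at_right_field intro!: exI[of _ \<beta>] q_mono)
  ultimately have "q \<beta> \<le> ?m"
    by (intro tendsto_lowerbound[where F = "at_right 0" and f = q]) auto
  then have "ln (Z0 \<beta>) \<le> \<beta> * ?m + \<beta>\<^sup>2 / 2 * A"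
    using \<beta> unfolding q_def by (simp add: field_simps power2_eq_square)
  then have "exp (ln (Z0 \<beta>)) \<le> exp (\<beta> * ?m + \<beta>\<^sup>2 / 2 * A)" by simp
  then show ?thesis unfolding exp_ln[OF Z0] by (simp only: Z0_def)
qed

end

end

section \<open>From the entropy bounds to the tail estimate\<close>

lemma (in prob_space) measure_deviation_le_exp:
  assumes f: "f \<in> borel_measurable M" "\<And>x. x \<in> space M \<Longrightarrow> \<bar>f x\<bar> \<le> C"
    and mgf: "(\<integral>x. exp (\<beta> * f x) \<partial>M) \<le> exp (\<beta> * (\<integral>x. f x \<partial>M) + \<beta>\<^sup>2 / 2 * A)"
    and \<beta>: "\<beta> > 0"
  shows "measure M {x \<in> space M. f x - (\<integral>z. f z \<partial>M) > t} \<le> exp (\<beta>\<^sup>2 / 2 * A - \<beta> * t)"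
proof -
  note [measurable] = f(1)
  let ?m = "\<integral>z. f z \<partial>M"
  have int: "integrable M (\<lambda>x. exp (\<beta> * f x))"
    using integrable_mult_exp_scaled[OF f, of "\<lambda>_. 1" 1 \<beta>] by simp
  have "measure M {x \<in> space M. f x - ?m > t} \<le> measure M {x \<in> space M. exp (\<beta> * f x) \<ge> exp (\<beta> * (?m + t))}"
    using \<beta> by (intro finite_measure_mono) auto
  also have "\<dots> \<le> (\<integral>x. exp (\<beta> * f x) \<partial>M) / exp (\<beta> * (?m + t))"
    by (rule integral_Markov_inequality_measure[OF int sets.top]) auto
  also have "\<dots> \<le> exp (\<beta> * ?m + \<beta>\<^sup>2 / 2 * A) / exp (\<beta> * (?m + t))"
    using mgf by (intro divide_right_mono) auto
  also have "\<dots> = exp (\<beta>\<^sup>2 / 2 * A - \<beta> * t)"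
    by (simp add: exp_diff[symmetric] algebra_simps)
  finally show ?thesis .
qed

text \<open>Herbst's argument needs a bound for the entropy of exp (s f). Subadditivity reduces it
  to entropies of sections, where the midpoint lemma applies with the infimum and supremum over
  coordinate k as a and b. Redrawing that coordinate turns each resulting term into the integral of
  \<open>B k\<close> against exp (s f), and the terms are then added.\<close>

lemma mgf_le_of_midpoint:
  fixes f :: "(nat \<Rightarrow> 'a) \<Rightarrow> real" and A \<beta> C :: real
  assumes M: "\<And>i. prob_space (M i)" and I: "finite I"
  defines "P \<equiv> Pi\<^sub>M I M"
  defines "B \<equiv> (\<lambda>k x. (coord_sup M k f x - coord_expectation M k f x) *
      (coord_expectation M k f x - coord_inf M k f x))"
  assumes f_meas [measurable]: "f \<in> borel_measurable P"
    and f_bound: "\<And>x. x \<in> space P \<Longrightarrow> \<bar>f x\<bar> \<le> C"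
    and B_meas: "\<And>k. k \<in> I \<Longrightarrow> B k \<in> borel_measurable P"
    and B_bound: "\<And>k x. k \<in> I \<Longrightarrow> x \<in> space P \<Longrightarrow> \<bar>B k x\<bar> \<le> D"
    and midpoint: "\<And>k x. k \<in> I \<Longrightarrow> x \<in> space P \<Longrightarrow>
      coord_expectation M k f x \<ge> (coord_sup M k f x + coord_inf M k f x) / 2"
    and A: "AE x in P. (\<Sum>k\<in>I. B k x) \<le> A"
    and "\<beta> > 0"
  shows "(\<integral>x. exp (\<beta> * f x) \<partial>P) \<le> exp (\<beta> * (\<integral>x. f x \<partial>P) + \<beta>\<^sup>2 / 2 * A)"
proof -
  interpret P: prob_space P unfolding P_def by (intro prob_space_PiM M)
  interpret M: prob_space "M i" for i by (rule M)
  show ?thesis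
  proof (rule P.herbst[OF f_meas f_bound _ \<open>\<beta> > 0\<close>])
    fix s :: real assume s: "s > 0"
    have intB: "integrable P (\<lambda>x. B k x * exp (s * f x))" if "k \<in> I" for k
      using that B_meas B_bound by (intro P.integrable_mult_exp_scaled[OF f_meas f_bound]) auto
    have "entropy_exp P (\<lambda>x. s * f x)
        \<le> (\<Sum>k\<in>I. \<integral>x. entropy_exp (M k) (\<lambda>y. s * f (x(k := y))) \<partial>P)"
      unfolding P_def using f_meas P.scaled_bound[OF f_meas f_bound, of _ s]
      by (intro entropy_exp_PiM_le[where K = "\<bar>s\<bar> * C"] M I) (auto simp: P_def)
    also have "\<dots> \<le> (\<Sum>k\<in>I. s\<^sup>2 / 2 * (\<integral>x. B k x * exp (s * f x) \<partial>P))"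
    proof (rule sum_mono)
      fix k assume k: "k \<in> I"
      have upd: "x(k := y) \<in> space P" if "x \<in> space P" "y \<in> space (M k)" for x y
        using space_PiM_update[OF k, of x M y] that unfolding P_def by simp
      have fk [measurable]: "(\<lambda>y. f (x(k := y))) \<in> borel_measurable (M k)" if "x \<in> space P" for x
        using measurable_update_section[OF f_meas[unfolded P_def], of k I x] that k
        unfolding P_def by (simp add: insert_absorb)
      have fm: "(\<lambda>(x, y). f (x(k := y))) \<in> borel_measurable (P \<Otimes>\<^sub>M M k)"
        using measurable_case_update[OF f_meas[unfolded P_def], of k I] k
        unfolding P_def by (simp add: insert_absorb)
      let ?Z = "\<lambda>x. \<integral>y. exp (s * f (x(k := y))) \<partial>M k"
      let ?e = "\<lambda>x. entropy_exp (M k) (\<lambda>y. s * f (x(k := y)))"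
      have ent_le: "?e x \<le> s\<^sup>2 / 2 * (?Z x * B k x)" if x: "x \<in> space P" for x
        unfolding B_def coord_expectation_def
      proof (rule M.entropy_exp_le_midpoint[OF fk[OF x]])
        fix y assume y: "y \<in> space (M k)"
        show "\<bar>f (x(k := y))\<bar> \<le> C" using f_bound[OF upd[OF x y]] .
        have "bdd_below ((\<lambda>y. f (x(k := y))) ` space (M k))" "bdd_above ((\<lambda>y. f (x(k := y))) ` space (M k))"
          using f_bound[OF upd[OF x]] by (auto intro!: bdd_belowI[of _ "- C"] bdd_aboveI[of _ C] simp: abs_le_iff minus_le_iff)
        then show "coord_inf M k f x \<le> f (x(k := y)) \<and> f (x(k := y)) \<le> coord_sup M k f x"
          unfolding coord_inf_def coord_sup_def using y by (auto intro: cINF_lower cSUP_upper)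
      next
        show "(coord_inf M k f x + coord_sup M k f x) / 2 \<le> (\<integral>y. f (x(k := y)) \<partial>M k)"
          using midpoint[OF k x] by (simp add: coord_expectation_def add.commute)
      qed (use s in simp)
      have sb: "\<bar>s * f (x(k := y))\<bar> \<le> \<bar>s\<bar> * C" if "x \<in> space P" "y \<in> space (M k)" for x y
        using P.scaled_bound[OF f_meas f_bound upd[OF that]] .
      have e_int: "integrable P ?e"
      proof (rule P.integrable_bounded)
        show "?e \<in> borel_measurable P"
          using fm by (intro entropy_exp_measurable M.sigma_finite_measure_axioms)
            (simp add: split_beta')
        show "\<bar>?e x\<bar> \<le> 2 * (\<bar>s\<bar> * C * exp (\<bar>s\<bar> * C))" if "x \<in> space P" for x
          using that sb by (intro M.abs_entropy_exp_le) auto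
      qed
      \<comment> \<open>\<open>B k x\<close> does not depend on coordinate k of x, so it may be
        moved under the inner integral. This gives the integrand the form required by
        \<open>integral_PiM_coord\<close>.\<close>
      have "B k (x(k := y)) = B k x" for x y
        unfolding B_def coord_sup_def coord_inf_def coord_expectation_def by simp
      then have ZB: "(\<integral>y. B k (x(k := y)) * exp (s * f (x(k := y))) \<partial>M k) = ?Z x * B k x" for x
        by simp
      have Z_int: "integrable P (\<lambda>x. ?Z x * B k x)"
      proof (rule P.integrable_bounded)
        have "?Z \<in> borel_measurable P"
          using fm by (intro M.borel_measurable_lebesgue_integral) (simp add: split_beta')
        then show "(\<lambda>x. ?Z x * B k x) \<in> borel_measurable P" using B_meas[OF k] by simp
        show "\<bar>?Z x * B k x\<bar> \<le> exp (\<bar>s\<bar> * C) * D" if x: "x \<in> space P" for x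
        proof -
          have "0 < ?Z x" "?Z x \<le> exp (\<bar>s\<bar> * C)"
            using M.integral_exp_pos[of "\<lambda>y. s * f (x(k := y))" k "\<bar>s\<bar> * C"]
              M.integral_exp_bounds(2)[of "\<lambda>y. s * f (x(k := y))" k "\<bar>s\<bar> * C"] sb[OF x] x fk[OF x]
            by auto
          then show ?thesis
            unfolding abs_mult using B_bound[OF k x] by (intro mult_mono) auto
        qed
      qed
      have "(\<integral>x. ?e x \<partial>P) \<le> (\<integral>x. s\<^sup>2 / 2 * (?Z x * B k x) \<partial>P)"
        using e_int Z_int ent_le by (intro integral_mono) auto
      also have "\<dots> = s\<^sup>2 / 2 * (\<integral>x. ?Z x * B k x \<partial>P)" by simp
      also have "(\<integral>x. ?Z x * B k x \<partial>P) = (\<integral>x. B k x * exp (s * f x) \<partial>P)"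
        unfolding ZB[symmetric] P_def
      proof (rule integral_PiM_coord[OF M I k])
        show "(\<lambda>x. B k x * exp (s * f x)) \<in> borel_measurable (Pi\<^sub>M I M)"
          using B_meas[OF k] f_meas unfolding P_def by simp
        show "\<bar>B k x * exp (s * f x)\<bar> \<le> D * exp (\<bar>s\<bar> * C)" if "x \<in> space (Pi\<^sub>M I M)" for x
        proof -
          have x: "x \<in> space P" using that by (simp add: P_def)
          have "s * f x \<le> \<bar>s\<bar> * C" using P.scaled_bound[OF f_meas f_bound x, of s] by simp
          moreover have "0 \<le> D" using B_bound[OF k x] by linarith
          ultimately show ?thesis
            unfolding abs_mult using B_bound[OF k x] by (intro mult_mono) auto
        qed
      qed
      finally show "(\<integral>x. ?e x \<partial>P) \<le> s\<^sup>2 / 2 * (\<integral>x. B k x * exp (s * f x) \<partial>P)" .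
    qed
    also have "\<dots> = s\<^sup>2 / 2 * (\<integral>x. (\<Sum>k\<in>I. B k x) * exp (s * f x) \<partial>P)"
      using intB by (simp add: sum_distrib_left[symmetric] sum_distrib_right Bochner_Integration.integral_sum)
    \<comment> \<open>A bounds only the sum of the \<open>B k\<close>, and only almost everywhere.
      Hence the sum is taken inside the integral before A is used.\<close>
    also have "\<dots> \<le> s\<^sup>2 / 2 * (\<integral>x. A * exp (s * f x) \<partial>P)"
    proof (intro mult_left_mono integral_mono_AE)
      show "integrable P (\<lambda>x. (\<Sum>k\<in>I. B k x) * exp (s * f x))"
        using intB by (simp add: sum_distrib_right)
      show "integrable P (\<lambda>x. A * exp (s * f x))"
        using P.integrable_mult_exp_scaled[OF f_meas f_bound, of "\<lambda>_. A" "\<bar>A\<bar>" s] by simp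
      show "AE x in P. (\<Sum>k\<in>I. B k x) * exp (s * f x) \<le> A * exp (s * f x)"
        using A by eventually_elim (intro mult_right_mono, auto)
    qed auto
    finally show "entropy_exp P (\<lambda>x. s * f x) \<le> s\<^sup>2 / 2 * (A * (\<integral>x. exp (s * f x) \<partial>P))" by simp
  qed
qed

text \<open>\<open>real_of_ereal\<close> sends infinite values to 0, so the essential supremum must
  first be shown finite: the uniform bound D limits it from above and 0 from below.\<close>

lemma (in prob_space) Linfty_norm_bounds:
  assumes g: "g \<in> borel_measurable M" "\<And>x. x \<in> space M \<Longrightarrow> \<bar>g x\<bar> \<le> D"
  shows "AE x in M. \<bar>g x\<bar> \<le> Linfty_norm M g" and "0 \<le> Linfty_norm M g"
proof -
  note [measurable] = g(1)
  let ?e = "esssup M (\<lambda>x. ereal \<bar>g x\<bar>)"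
  have ae: "AE x in M. ereal \<bar>g x\<bar> \<le> ?e" by (rule esssup_AE)
  \<comment> \<open>The inequality does not depend on x; as the measure is not zero, holding almost
    everywhere means holding outright.\<close>
  then have "AE x in M. 0 \<le> ?e"
    by eventually_elim (meson abs_ge_zero ereal_less_eq(5) order_trans)
  then have "0 \<le> ?e" by simp
  moreover have "?e \<le> ereal D" using g(2) by (intro esssup_I) auto
  ultimately have e: "?e = ereal (Linfty_norm M g)" "0 \<le> Linfty_norm M g"
    unfolding Linfty_norm_def by (cases ?e; auto)+
  from ae show "AE x in M. \<bar>g x\<bar> \<le> Linfty_norm M g" unfolding e(1) by simp
  show "0 \<le> Linfty_norm M g" by (rule e(2))
qed

lemma coord_bounds:
  assumes M: "prob_space (M k)" and "k \<in> I" and f: "f \<in> borel_measurable (Pi\<^sub>M I M)"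
    "\<And>x. x \<in> space (Pi\<^sub>M I M) \<Longrightarrow> \<bar>f x\<bar> \<le> C"
    and x: "x \<in> space (Pi\<^sub>M I M)"
  shows "\<bar>coord_sup M k f x\<bar> \<le> C" "\<bar>coord_inf M k f x\<bar> \<le> C" "\<bar>coord_expectation M k f x\<bar> \<le> C"
proof -
  interpret prob_space "M k" by fact
  have b: "- C \<le> f (x(k := y))" "f (x(k := y)) \<le> C" if "y \<in> space (M k)" for y
    using f(2)[OF space_PiM_update[OF \<open>k \<in> I\<close> x that]] by (auto simp: abs_le_iff)
  have m: "(\<lambda>y. f (x(k := y))) \<in> borel_measurable (M k)"
    using \<open>k \<in> I\<close> by (intro measurable_update_section[OF f(1) _ x]) auto
  show "\<bar>coord_expectation M k f x\<bar> \<le> C"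
    using integral_bounds[OF m, of "- C" C] b by (auto simp: coord_expectation_def abs_le_iff)
  \<comment> \<open>A probability space is nonempty. Together with the bounds by C, this makes the
    real-valued supremum and infimum the genuine ones.\<close>
  obtain y where y: "y \<in> space (M k)" using not_empty by blast
  have bdd: "bdd_below ((\<lambda>y. f (x(k := y))) ` space (M k))" "bdd_above ((\<lambda>y. f (x(k := y))) ` space (M k))"
    using b by (auto intro!: bdd_belowI[of _ "- C"] bdd_aboveI[of _ C])
  have "- C \<le> coord_inf M k f x" "coord_sup M k f x \<le> C"
    unfolding coord_inf_def coord_sup_def using b not_empty by (auto intro!: cINF_greatest cSUP_least)
  moreover have "coord_inf M k f x \<le> f (x(k := y))" "f (x(k := y)) \<le> coord_sup M k f x"
    unfolding coord_inf_def coord_sup_def using bdd y by (auto intro: cINF_lower cSUP_upper)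
  ultimately show "\<bar>coord_sup M k f x\<bar> \<le> C" "\<bar>coord_inf M k f x\<bar> \<le> C"
    using b[OF y] by (auto simp: abs_le_iff)
qed

theorem theorem12:
  fixes n :: nat
    and M :: "nat \<Rightarrow> 'a measure"
    and P :: "(nat \<Rightarrow> 'a) measure"
    and f :: "(nat \<Rightarrow> 'a) \<Rightarrow> real"
    and A t :: real
  assumes prob: "\<And>k. k \<in> {1..n} \<Longrightarrow> prob_space (M k)"
    and P_eq: "P = (\<Pi>\<^sub>M k\<in>{1..n}. M k)"
    and f_meas: "f \<in> borel_measurable P"
    and f_bounded: "bounded (f ` space P)"
    and sup_meas: "\<And>k. k \<in> {1..n} \<Longrightarrow> coord_sup M k f \<in> borel_measurable P"
    and inf_meas: "\<And>k. k \<in> {1..n} \<Longrightarrow> coord_inf M k f \<in> borel_measurable P"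
    and midpoint: "\<And>k x. k \<in> {1..n} \<Longrightarrow> x \<in> space P \<Longrightarrow>
      coord_expectation M k f x \<ge> (coord_sup M k f x + coord_inf M k f x) / 2"
    and A_eq: "A = Linfty_norm P (\<lambda>x. \<Sum>k\<in>{1..n}.
      (coord_sup M k f x - coord_expectation M k f x) *
      (coord_expectation M k f x - coord_inf M k f x))"
    and t_pos: "t > 0"
  shows "measure P {x \<in> space P. f x - (\<integral>z. f z \<partial>P) > t}
    \<le> (if A = 0 then 0 else exp (- (t\<^sup>2 / (2 * A))))"
proof -
  text \<open>The index type is infinite, but only the factors in \<open>{1..n}\<close> are known to be probability spaces.\<close>
  define N where "N k = (if k \<in> {1..n} then M k else return (count_space UNIV) undefined)" for k
  have N: "prob_space (N k)" for k
    unfolding N_def using prob by (auto intro!: prob_space_return)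
  have NM: "N k = M k" if "k \<in> {1..n}" for k using that by (simp add: N_def)
  have PN: "P = Pi\<^sub>M {1..n} N" unfolding P_eq by (intro PiM_cong) (simp_all add: NM)
  have coord: "coord_sup N k f = coord_sup M k f" "coord_inf N k f = coord_inf M k f"
    "coord_expectation N k f = coord_expectation M k f" if "k \<in> {1..n}" for k
    by (simp_all add: fun_eq_iff coord_sup_def coord_inf_def coord_expectation_def NM[OF that])
  interpret P: prob_space P unfolding PN by (intro prob_space_PiM N)
  obtain C where C: "\<And>x. x \<in> space P \<Longrightarrow> \<bar>f x\<bar> \<le> C"
    using f_bounded by (auto simp: bounded_iff)
  define B where "B k x = (coord_sup M k f x - coord_expectation M k f x) *
      (coord_expectation M k f x - coord_inf M k f x)" for k x
  have B_meas: "B k \<in> borel_measurable P" if k: "k \<in> {1..n}" for k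
  proof -
    have "sigma_finite_measure (M k)" using prob[OF k] by (rule prob_space_imp_sigma_finite)
    then have "coord_expectation M k f \<in> borel_measurable P"
      unfolding coord_expectation_def[abs_def]
      by (rule sigma_finite_measure.borel_measurable_lebesgue_integral)
        (use f_meas k in \<open>auto simp: P_eq intro!: measurable_case_update\<close>)
    then show ?thesis
      unfolding B_def[abs_def] using sup_meas[OF k] inf_meas[OF k] by simp
  qed
  \<comment> \<open>Each factor is a difference of two quantities of absolute value at most
    C.\<close>
  have B_bound: "\<bar>B k x\<bar> \<le> 2 * C * (2 * C)" if k: "k \<in> {1..n}" and x: "x \<in> space P" for k x
    unfolding B_def abs_mult
    using coord_bounds[OF prob[OF k] k f_meas[unfolded P_eq] C[unfolded P_eq] x[unfolded P_eq]]
    by (intro mult_mono) auto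
  have sum_meas: "(\<lambda>x. \<Sum>k\<in>{1..n}. B k x) \<in> borel_measurable P" using B_meas by simp
  have sum_bound: "\<bar>\<Sum>k\<in>{1..n}. B k x\<bar> \<le> (\<Sum>k\<in>{1..n}. 2 * C * (2 * C))" if "x \<in> space P" for x
    using B_bound that by (intro order_trans[OF sum_abs] sum_mono)
  have A_def: "A = Linfty_norm P (\<lambda>x. \<Sum>k\<in>{1..n}. B k x)" unfolding A_eq B_def ..
  have AE: "AE x in P. (\<Sum>k\<in>{1..n}. B k x) \<le> A"
    using P.Linfty_norm_bounds(1)[OF sum_meas sum_bound] unfolding A_def by (rule AE_mp) auto
  have A0: "0 \<le> A"
    using P.Linfty_norm_bounds(2)[OF sum_meas sum_bound] unfolding A_def by auto
  have mgf: "(\<integral>x. exp (\<beta> * f x) \<partial>P) \<le> exp (\<beta> * (\<integral>x. f x \<partial>P) + \<beta>\<^sup>2 / 2 * A)" if "\<beta> > 0" for \<beta>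
    unfolding PN
  proof (rule mgf_le_of_midpoint[OF N, where C = C and D = "2 * C * (2 * C)"], unfold PN[symmetric])
    show "finite {1..n}" "\<beta> > 0" "f \<in> borel_measurable P" by (simp_all add: that f_meas)
    show "\<bar>f x\<bar> \<le> C" if "x \<in> space P" for x by (rule C[OF that])
    show "(\<lambda>x. (coord_sup N k f x - coord_expectation N k f x) *
        (coord_expectation N k f x - coord_inf N k f x)) \<in> borel_measurable P" if "k \<in> {1..n}" for k
      using B_meas[OF that] unfolding coord[OF that] B_def[abs_def] .
    show "\<bar>(coord_sup N k f x - coord_expectation N k f x) *
        (coord_expectation N k f x - coord_inf N k f x)\<bar> \<le> 2 * C * (2 * C)"
      if "k \<in> {1..n}" "x \<in> space P" for k x
      using B_bound[OF that] unfolding coord[OF that(1)] B_def .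
    show "coord_expectation N k f x \<ge> (coord_sup N k f x + coord_inf N k f x) / 2"
      if "k \<in> {1..n}" "x \<in> space P" for k x
      using midpoint[OF that] unfolding coord[OF that(1)] .
    have "(\<Sum>k\<in>{1..n}. (coord_sup N k f x - coord_expectation N k f x) *
        (coord_expectation N k f x - coord_inf N k f x)) = (\<Sum>k\<in>{1..n}. B k x)" for x
      unfolding B_def by (rule sum.cong[OF refl]) (simp only: coord)
    then show "AE x in P. (\<Sum>k\<in>{1..n}. (coord_sup N k f x - coord_expectation N k f x) *
        (coord_expectation N k f x - coord_inf N k f x)) \<le> A"
      using AE by (simp only:)
  qed
  let ?p = "measure P {x \<in> space P. f x - (\<integral>z. f z \<partial>P) > t}"
  have p_le: "?p \<le> exp (\<beta>\<^sup>2 / 2 * A - \<beta> * t)" if "\<beta> > 0" for \<beta>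
    by (rule P.measure_deviation_le_exp[OF f_meas C mgf[OF that] that])
  show ?thesis
  proof (cases "A = 0")
    case True
    have "?p \<le> 0"
    proof (rule ccontr)
      assume "\<not> ?p \<le> 0"
      then have p: "?p > 0" by simp
      have "ln ?p \<le> 0" using p P.prob_le_1 by simp
      \<comment> \<open>For A = 0 the tail is at most exp (- \<beta> t) for every \<beta> > 0. The
        choice \<beta> = (1 - ln \<open>?p\<close>) / t, positive because ln \<open>?p\<close> <= 0,
        makes this bound smaller than \<open>?p\<close> itself.\<close>
      then have "?p \<le> exp (ln ?p - 1)"
        using p_le[of "(1 - ln ?p) / t"] True t_pos by simp
      also have "\<dots> < exp (ln ?p)" by simp
      finally show False using p by simp
    qed
    then show ?thesis using True by simp
  next
    case False
    then have "A > 0" using A0 by simp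
    \<comment> \<open>\<beta> = t / A minimises the exponent \<beta>^2 A / 2 - \<beta> t.\<close>
    then have "(t / A)\<^sup>2 / 2 * A - t / A * t = - (t\<^sup>2 / (2 * A))"
      by (simp add: field_simps power2_eq_square)
    then show ?thesis using p_le[of "t / A"] False \<open>A > 0\<close> t_pos by simp
  qed
qed

end
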